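(* Let $A$ be a von Neumann regular ring and $E$ a multiplication $A$-module. Then the idealization $A(+)E$ is an SSP-ring.
   Context: All rings are commutative with $1$. A ring $A$ is von Neumann regular if for every $a\in A$ there is $b\in A$ with $a=a^2b$. An $A$-module $E$ is a multiplication module if for each submodule $F$ of $E$ there is an ideal $I$ of $A$ with $F=IE$. The idealization $A(+)E$ is the ring with additive group $A\oplus E$ and multiplication $(a,x)(b,y)=(ab,ay+bx)$ for $a,b\in A$, $x,y\in E$. An ideal $I$ is radical if $\sqrt{I}=I$ (the whole ring counts as a radical ideal). An SSP-ring is a ring in which every ideal is a (finite) product of radical ideals. *)

theory Defs
  imports "HOL-Algebra.Module" "HOL-Algebra.Ideal_Product"
begin

locale von_neumann_regular_ring = cring +
  assumes regular: "a \<in> carrier R \<Longrightarrow> \<exists>b \<in> carrier R. a = a [^] (2::nat) \<otimes> b"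

text \<open>The submodule \<open>I E\<close> consists of the finite sums of products \<open>a \<odot> x\<close> with \<open>a \<in> I\<close> and
  \<open>x \<in> E\<close>. As with \<^const>\<open>ideal_prod\<close>, nonempty sums suffice, since \<open>I\<close> is
  meant to be an ideal and hence contains zero.\<close>

inductive_set ideal_smult :: "'a set \<Rightarrow> ('a, 'b, 'n) module_scheme \<Rightarrow> 'b set"
  for I and E (structure) where
    smult: "\<lbrakk> a \<in> I; x \<in> carrier E \<rbrakk> \<Longrightarrow> a \<odot> x \<in> ideal_smult I E"
  | sum: "\<lbrakk> x \<in> ideal_smult I E; y \<in> ideal_smult I E \<rbrakk> \<Longrightarrow> x \<oplus> y \<in> ideal_smult I E"

locale multiplication_module = module +
  assumes multiplication: "submodule F R M \<Longrightarrow> \<exists>I. ideal I R \<and> F = ideal_smult I M"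

definition idealization :: "('a, 'm) ring_scheme \<Rightarrow> ('a, 'b, 'n) module_scheme \<Rightarrow> ('a \<times> 'b) ring"
  where "idealization A E =
    \<lparr> carrier = carrier A \<times> carrier E,
      mult = (\<lambda>(a, x) (b, y). (a \<otimes>\<^bsub>A\<^esub> b, a \<odot>\<^bsub>E\<^esub> y \<oplus>\<^bsub>E\<^esub> b \<odot>\<^bsub>E\<^esub> x)),
      one = (\<one>\<^bsub>A\<^esub>, \<zero>\<^bsub>E\<^esub>),
      zero = (\<zero>\<^bsub>A\<^esub>, \<zero>\<^bsub>E\<^esub>),
      add = (\<lambda>(a, x) (b, y). (a \<oplus>\<^bsub>A\<^esub> b, x \<oplus>\<^bsub>E\<^esub> y)) \<rparr>"

definition ideal_radical :: "('a, 'm) ring_scheme \<Rightarrow> 'a set \<Rightarrow> 'a set"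
  where "ideal_radical R I = {a \<in> carrier R. \<exists>n::nat. n > 0 \<and> a [^]\<^bsub>R\<^esub> n \<in> I}"

locale radical_ideal = ideal +
  assumes radical: "ideal_radical R I = I"

text \<open>The empty list gives the empty product, the whole ring, which is itself a radical ideal.\<close>

locale SSP_ring = cring +
  assumes product_of_radical_ideals:
    "ideal I R \<Longrightarrow>
      \<exists>Js. (\<forall>J \<in> set Js. radical_ideal J R) \<and> I = foldr (ideal_prod R) Js (carrier R)"

end

theory Submission
  imports Defs
begin

text \<open>
  Over a von Neumann regular ring \<open>A\<close> every ideal is radical, and because \<open>0 \<times> E\<close> squares to
  zero in the idealization, this makes every \<open>I \<times> E\<close> with \<open>I\<close> an ideal of \<open>A\<close> a
  radical ideal of \<open>A (+) E\<close>.  Products of two of these already suffice.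

  Two facts carry the proof.  First, every ideal of \<open>A (+) E\<close> is homogeneous, that is, of the form
  \<open>I \<times> N\<close> with \<open>I\<close> an ideal, \<open>N\<close> a submodule and \<open>I E \<subseteq> N\<close>
  (\<open>ideal_idealization_homogeneous\<close>): if it contains \<open>(a, x)\<close> and \<open>e = a b\<close>
  is the idempotent generating \<open>a A\<close>, it contains \<open>(e, b x)\<close> and hence
  \<open>(e, b x) (e, - b x) = (e, 0)\<close>, which separates \<open>a\<close> from \<open>x\<close>.
  Second, if \<open>I \<subseteq> L\<close> then \<open>I L = I\<close> by regularity, so that
  \<open>(I \<times> E) (L \<times> E) = I L \<times> (I + L) E = I \<times> L E\<close>
  (\<open>ideal_prod_idealization\<close>).  Given \<open>I \<times> N\<close>, the multiplication property gives
  \<open>N = K E\<close>, and \<open>L = I + K\<close> contains \<open>I\<close> and satisfies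
  \<open>L E = I E + K E = N\<close>; thus \<open>I \<times> N = (I \<times> E) (L \<times> E)\<close>.
\<close>

section \<open>Ideals in von Neumann regular rings\<close>

text \<open>Multiplication by \<open>- 1\<close> provides the negatives, so the additive inverse of the
  idealization never has to be computed.\<close>

lemma (in cring) ideal_if_closed:
  assumes "I \<subseteq> carrier R" "\<zero> \<in> I"
    and "\<And>a b. a \<in> I \<Longrightarrow> b \<in> I \<Longrightarrow> a \<oplus> b \<in> I"
    and "\<And>a x. a \<in> I \<Longrightarrow> x \<in> carrier R \<Longrightarrow> x \<otimes> a \<in> I"
  shows "ideal I R"
proof (rule idealI)
  have "\<ominus> a \<in> I" if "a \<in> I" for a
    using assms(1) assms(4)[of a "\<ominus> \<one>"] that by (auto simp: l_minus)
  then show "subgroup I (add_monoid R)"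
    using assms(1-3) by (intro add.subgroupI) (auto simp: a_inv_def)
  show "a \<otimes> x \<in> I" if "a \<in> I" "x \<in> carrier R" for a x
    using assms(1) assms(4)[OF that] that by (simp add: m_comm subset_iff)
qed (use assms ring_axioms in auto)

text \<open>Repeated substitution in \<open>a = a\<^sup>2 b\<close> gives \<open>a = a\<^sup>n b\<^sup>n\<^sup>-\<^sup>1\<close>,
  so an ideal that contains a positive power of \<open>a\<close> contains \<open>a\<close>.\<close>

lemma (in von_neumann_regular_ring) ideal_mem_of_power_mem:
  assumes "ideal I R" "a \<in> carrier R" "0 < (n::nat)" "a [^] n \<in> I"
  shows "a \<in> I"
proof -
  interpret ideal I R by fact
  obtain b where b: "b \<in> carrier R" "a = a [^] (2::nat) \<otimes> b"
    using regular[OF assms(2)] by blast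
  have ab: "a = a \<otimes> (a \<otimes> b)"
    using b assms(2) by (simp add: numeral_2_eq_2 m_assoc)
  have "a = a [^] Suc m \<otimes> b [^] m" for m
  proof (induction m)
    case (Suc m)
    have "a [^] Suc (Suc m) \<otimes> b [^] Suc m = (a [^] Suc m \<otimes> b [^] m) \<otimes> (a \<otimes> b)"
      using assms(2) b(1) by (simp add: m_ac)
    also have "\<dots> = a" using Suc ab by simp
    finally show ?case by simp
  qed (use assms(2) in simp)
  from this[of "n - 1"] have "a = a [^] n \<otimes> b [^] (n - 1)" using assms(3) by simp
  also have "\<dots> \<in> I" using I_r_closed[OF assms(4)] b(1) by simp
  finally show ?thesis .
qed

section \<open>The idealization and its ideals\<close>

lemma idealization_simps:
  "carrier (idealization A E) = carrier A \<times> carrier E"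
  "(a, x) \<otimes>\<^bsub>idealization A E\<^esub> (b, y) = (a \<otimes>\<^bsub>A\<^esub> b, a \<odot>\<^bsub>E\<^esub> y \<oplus>\<^bsub>E\<^esub> b \<odot>\<^bsub>E\<^esub> x)"
  "(a, x) \<oplus>\<^bsub>idealization A E\<^esub> (b, y) = (a \<oplus>\<^bsub>A\<^esub> b, x \<oplus>\<^bsub>E\<^esub> y)"
  "\<one>\<^bsub>idealization A E\<^esub> = (\<one>\<^bsub>A\<^esub>, \<zero>\<^bsub>E\<^esub>)"
  "\<zero>\<^bsub>idealization A E\<^esub> = (\<zero>\<^bsub>A\<^esub>, \<zero>\<^bsub>E\<^esub>)"
  by (simp_all add: idealization_def)

context module
begin

lemma smult_left_commute:
  assumes "a \<in> carrier R" "b \<in> carrier R" "x \<in> carrier M"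
  shows "a \<odot>\<^bsub>M\<^esub> (b \<odot>\<^bsub>M\<^esub> x) = b \<odot>\<^bsub>M\<^esub> (a \<odot>\<^bsub>M\<^esub> x)"
  using assms by (simp add: R.m_comm flip: smult_assoc1)

lemma cring_idealization: "cring (idealization R M)"
proof (rule cringI)
  have "\<exists>b\<in>carrier R. \<exists>y\<in>carrier M. b \<oplus> a = \<zero> \<and> y \<oplus>\<^bsub>M\<^esub> x = \<zero>\<^bsub>M\<^esub>"
    if "a \<in> carrier R" "x \<in> carrier M" for a x
    using that by (meson R.l_neg M.l_neg R.a_inv_closed M.a_inv_closed)
  then show "abelian_group (idealization R M)"
    by (intro abelian_groupI) (auto simp: idealization_simps R.a_ac M.a_ac)
  show "comm_monoid (idealization R M)"
    by (intro comm_monoidI)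
      (auto simp: idealization_simps R.m_ac M.a_ac smult_r_distr smult_assoc1 smult_left_commute)
qed (auto simp: idealization_simps R.l_distr M.a_ac smult_r_distr smult_l_distr)

lemma idealization_pow_fst:
  assumes "a \<in> carrier R"
  shows "fst ((a, x) [^]\<^bsub>idealization R M\<^esub> (n::nat)) = a [^] n"
proof (induction n)
  case (Suc n)
  then show ?case
    by (cases "(a, x) [^]\<^bsub>idealization R M\<^esub> n") (simp add: idealization_simps)
qed (simp add: idealization_simps)

lemma ideal_times_carrier:
  assumes "ideal I R"
  shows "ideal (I \<times> carrier M) (idealization R M)"
proof -
  interpret S: cring "idealization R M" by (rule cring_idealization)
  interpret I: ideal I R by fact
  show ?thesis
    by (rule S.ideal_if_closed)
      (auto simp: idealization_simps I.Icarr I.I_l_closed)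
qed

lemma submodule_zero_section:
  assumes "ideal J (idealization R M)"
  shows "submodule {x. (\<zero>, x) \<in> J} R M"
proof -
  interpret J: ideal J "idealization R M" by fact
  note J_add = additive_subgroup.a_closed[OF J.additive_subgroup_axioms]
  have J_carrier: "a \<in> carrier R \<and> x \<in> carrier M" if "(a, x) \<in> J" for a x
    using J.Icarr[OF that] by (simp add: idealization_simps)
  have smult: "(\<zero>, a \<odot>\<^bsub>M\<^esub> x) \<in> J" if "a \<in> carrier R" "(\<zero>, x) \<in> J" for a x
    using J.I_l_closed[OF that(2), of "(a, \<zero>\<^bsub>M\<^esub>)"] that J_carrier
    by (auto simp: idealization_simps)
  show ?thesis
  proof (rule submoduleI)
    show "\<ominus>\<^bsub>M\<^esub> x \<in> {x. (\<zero>, x) \<in> J}" if "x \<in> {x. (\<zero>, x) \<in> J}" for x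
      using smult[of "\<ominus> \<one>" x] that J_carrier[of \<zero> x] by (auto simp: smult_l_minus)
    show "x \<oplus>\<^bsub>M\<^esub> y \<in> {x. (\<zero>, x) \<in> J}"
      if "x \<in> {x. (\<zero>, x) \<in> J}" "y \<in> {x. (\<zero>, x) \<in> J}" for x y
      using J_add[of "(\<zero>, x)" "(\<zero>, y)"] that by (auto simp: idealization_simps)
  qed (use J_carrier smult additive_subgroup.zero_closed[OF J.additive_subgroup_axioms] in \<open>auto simp: idealization_simps\<close>)
qed

lemma ideal_zero_section:
  assumes "ideal J (idealization R M)"
  shows "ideal {a. (a, \<zero>\<^bsub>M\<^esub>) \<in> J} R"
proof -
  interpret J: ideal J "idealization R M" by fact
  note J_add = additive_subgroup.a_closed[OF J.additive_subgroup_axioms]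
  have J_carrier: "a \<in> carrier R" if "(a, \<zero>\<^bsub>M\<^esub>) \<in> J" for a
    using J.Icarr[OF that] by (simp add: idealization_simps)
  show ?thesis
  proof (rule R.ideal_if_closed)
    show "a \<oplus> b \<in> {a. (a, \<zero>\<^bsub>M\<^esub>) \<in> J}"
      if "a \<in> {a. (a, \<zero>\<^bsub>M\<^esub>) \<in> J}" "b \<in> {a. (a, \<zero>\<^bsub>M\<^esub>) \<in> J}" for a b
      using J_add[of "(a, \<zero>\<^bsub>M\<^esub>)" "(b, \<zero>\<^bsub>M\<^esub>)"] that by (auto simp: idealization_simps)
    show "r \<otimes> a \<in> {a. (a, \<zero>\<^bsub>M\<^esub>) \<in> J}"
      if "a \<in> {a. (a, \<zero>\<^bsub>M\<^esub>) \<in> J}" "r \<in> carrier R" for a r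
      using J.I_l_closed[of "(a, \<zero>\<^bsub>M\<^esub>)" "(r, \<zero>\<^bsub>M\<^esub>)"] that J_carrier
      by (auto simp: idealization_simps)
  qed (use J_carrier additive_subgroup.zero_closed[OF J.additive_subgroup_axioms] in \<open>auto simp: idealization_simps\<close>)
qed

text \<open>Enlarging \<open>K\<close> by an ideal \<open>I\<close> with \<open>I E \<subseteq> K E\<close> does not change
  \<open>K E\<close>; this is what allows the second factor of the product to contain the first.\<close>

lemma ideal_smult_add_absorb:
  assumes I: "ideal I R" and K: "ideal K R"
    and absorb: "\<And>a x. a \<in> I \<Longrightarrow> x \<in> carrier M \<Longrightarrow> a \<odot>\<^bsub>M\<^esub> x \<in> ideal_smult K M"
  shows "ideal_smult (I <+>\<^bsub>R\<^esub> K) M = ideal_smult K M"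
proof (intro equalityI subsetI)
  fix x assume "x \<in> ideal_smult (I <+>\<^bsub>R\<^esub> K) M"
  then show "x \<in> ideal_smult K M"
  proof induction
    case (smult l x)
    then obtain i k where "i \<in> I" "k \<in> K" "l = i \<oplus> k"
      by (auto simp: set_add_def')
    with smult show ?case
      by (auto simp: smult_l_distr ideal.Icarr[OF I] ideal.Icarr[OF K]
          intro: ideal_smult.intros absorb)
  qed (rule ideal_smult.sum)
next
  fix x assume "x \<in> ideal_smult K M"
  then show "x \<in> ideal_smult (I <+>\<^bsub>R\<^esub> K) M"
  proof induction
    case (smult k x)
    have "\<zero> \<oplus> k \<in> I <+>\<^bsub>R\<^esub> K"
      using smult additive_subgroup.zero_closed[OF ideal.axioms(1)[OF I]]
      by (auto simp: set_add_def')
    then show ?case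
      using smult by (simp add: ideal.Icarr[OF K] ideal_smult.smult)
  qed (rule ideal_smult.sum)
qed

end

section \<open>Idealization over a von Neumann regular ring\<close>

locale module_over_von_neumann_regular_ring = module + von_neumann_regular_ring
begin

lemma radical_ideal_times_carrier:
  assumes "ideal I R"
  shows "radical_ideal (I \<times> carrier M) (idealization R M)"
proof -
  interpret S: cring "idealization R M" by (rule cring_idealization)
  interpret P: ideal "I \<times> carrier M" "idealization R M" by (rule ideal_times_carrier) fact
  have "p \<in> I \<times> carrier M"
    if p: "p \<in> carrier (idealization R M)" "0 < n" "p [^]\<^bsub>idealization R M\<^esub> n \<in> I \<times> carrier M"
    for p and n :: nat
  proof -
    obtain a x where ax: "p = (a, x)" "a \<in> carrier R" "x \<in> carrier M"
      using p(1) by (auto simp: idealization_simps)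
    with p(3) have "a [^] n \<in> I"
      using idealization_pow_fst[of a x n] by (auto simp: mem_Times_iff)
    then show ?thesis
      using ideal_mem_of_power_mem assms ax p(2) by blast
  qed
  moreover have "\<exists>n::nat. 0 < n \<and> p [^]\<^bsub>idealization R M\<^esub> n \<in> I \<times> carrier M"
    if "p \<in> I \<times> carrier M" for p
    using that P.Icarr[OF that] by (intro exI[of _ "1::nat"]) simp
  ultimately have "ideal_radical (idealization R M) (I \<times> carrier M) = I \<times> carrier M"
    unfolding ideal_radical_def using P.Icarr
    by (intro Set.set_eqI) (simp only: mem_Collect_eq, metis)
  then show ?thesis
    by unfold_locales
qed

text \<open>The inclusion from right to left is where regularity enters: \<open>i = i (i b)\<close> writes
  \<open>(i, 0)\<close> as a product with second factor from \<open>I \<subseteq> L\<close>, and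
  \<open>(0, l x) = (0, x) (l, 0)\<close> supplies the second component.\<close>

lemma ideal_prod_idealization:
  assumes I: "ideal I R" and L: "ideal L R" and "I \<subseteq> L"
  shows "ideal_prod (idealization R M) (I \<times> carrier M) (L \<times> carrier M) = I \<times> ideal_smult L M"
    (is "?P = _")
proof -
  interpret I: ideal I R by fact
  interpret L: ideal L R by fact
  have smult_carrier: "x \<in> carrier M" if "x \<in> ideal_smult L M" for x
    using that by induction auto
  show ?thesis
  proof (intro equalityI subsetI)
    fix p assume "p \<in> ?P"
    then show "p \<in> I \<times> ideal_smult L M"
    proof induction
      case (prod p q)
      then show ?case
        using \<open>I \<subseteq> L\<close>
        by (auto simp: idealization_simps I.I_r_closed L.Icarr intro!: ideal_smult.intros)
    next
      case (sum p q)
      then show ?case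
        by (auto simp: idealization_simps intro: ideal_smult.intros)
    qed
  next
    fix p assume "p \<in> I \<times> ideal_smult L M"
    then obtain i x where p: "p = (i, x)" and i: "i \<in> I" and x: "x \<in> ideal_smult L M"
      by blast
    obtain b where b: "b \<in> carrier R" "i = i [^] (2::nat) \<otimes> b"
      using regular[OF I.Icarr[OF i]] by blast
    have "(i, \<zero>\<^bsub>M\<^esub>) \<otimes>\<^bsub>idealization R M\<^esub> (i \<otimes> b, \<zero>\<^bsub>M\<^esub>) \<in> ?P"
      using i b(1) \<open>I \<subseteq> L\<close> by (intro ideal_prod.prod) (auto intro: I.I_r_closed)
    then have i_mem: "(i, \<zero>\<^bsub>M\<^esub>) \<in> ?P"
      using b i by (simp add: idealization_simps I.Icarr numeral_2_eq_2 m_assoc)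
    have "(\<zero>, x) \<in> ?P"
      using x
    proof induction
      case (smult l x)
      then have "(\<zero>, x) \<otimes>\<^bsub>idealization R M\<^esub> (l, \<zero>\<^bsub>M\<^esub>) \<in> ?P"
        by (intro ideal_prod.prod) auto
      then show ?case
        using smult by (simp add: idealization_simps L.Icarr)
    next
      case (sum x y)
      then show ?case
        using ideal_prod.sum[OF sum.IH] by (simp add: idealization_simps)
    qed
    from ideal_prod.sum[OF i_mem this] show "p \<in> ?P"
      using i x by (simp add: p idealization_simps I.Icarr smult_carrier)
  qed
qed

text \<open>Regularity supplies an idempotent \<open>e\<close> with \<open>a e = a\<close>, and once
  \<open>(e, 0)\<close> lies in the ideal, so do \<open>(a, 0) = (e, 0) (a, 0)\<close> and the difference
  \<open>(0, x)\<close>.\<close>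

lemma ideal_idealization_homogeneous:
  assumes "ideal J (idealization R M)"
  shows "J = {a. (a, \<zero>\<^bsub>M\<^esub>) \<in> J} \<times> {x. (\<zero>, x) \<in> J}"
proof -
  interpret J: ideal J "idealization R M" by fact
  note J_add = additive_subgroup.a_closed[OF J.additive_subgroup_axioms]
  have split: "(a, \<zero>\<^bsub>M\<^esub>) \<in> J \<and> (\<zero>, x) \<in> J" if ax: "(a, x) \<in> J" for a x
  proof -
    have a: "a \<in> carrier R" and x: "x \<in> carrier M"
      using J.Icarr[OF ax] by (auto simp: idealization_simps)
    obtain b where b: "b \<in> carrier R" "a = a [^] (2::nat) \<otimes> b"
      using regular[OF a] by blast
    define e where "e = a \<otimes> b"
    define y where "y = b \<odot>\<^bsub>M\<^esub> x"
    have e: "e \<in> carrier R" and y: "y \<in> carrier M"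
      using a b x by (auto simp: e_def y_def)
    have ae: "a \<otimes> e = a"
      using a b by (simp add: e_def numeral_2_eq_2 m_assoc)
    then have ee: "e \<otimes> e = e"
      using a b e by (metis e_def R.m_assoc R.m_comm)
    have "(e, y) \<in> J"
      using J.I_r_closed[OF ax, of "(b, \<zero>\<^bsub>M\<^esub>)"] a b x
      by (simp add: idealization_simps e_def y_def)
    \<comment> \<open>\<open>(e, y)\<close> and its conjugate multiply to \<open>(e\<^sup>2, e y - e y) = (e, 0)\<close>.\<close>
    from J.I_r_closed[OF this, of "(e, \<ominus>\<^bsub>M\<^esub> y)"] have "(e, \<zero>\<^bsub>M\<^esub>) \<in> J"
      using e y ee by (simp add: idealization_simps smult_r_minus M.l_neg)
    from J.I_r_closed[OF this, of "(a, \<zero>\<^bsub>M\<^esub>)"] have a_mem: "(a, \<zero>\<^bsub>M\<^esub>) \<in> J"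
      using a e ae by (simp add: idealization_simps R.m_comm)
    from J.I_r_closed[OF this, of "(\<ominus> \<one>, \<zero>\<^bsub>M\<^esub>)"] have "(\<ominus> a, \<zero>\<^bsub>M\<^esub>) \<in> J"
      using a by (simp add: idealization_simps R.r_minus)
    from J_add[OF this ax] have "(\<zero>, x) \<in> J"
      using a x by (simp add: idealization_simps R.l_neg)
    with a_mem show ?thesis ..
  qed
  have join: "(a, x) \<in> J" if "(a, \<zero>\<^bsub>M\<^esub>) \<in> J" "(\<zero>, x) \<in> J" for a x
    using J_add[OF that] J.Icarr[OF that(1)] J.Icarr[OF that(2)]
    by (simp add: idealization_simps)
  show ?thesis
  proof (rule Set.set_eqI)
    fix p
    show "p \<in> J \<longleftrightarrow> p \<in> {a. (a, \<zero>\<^bsub>M\<^esub>) \<in> J} \<times> {x. (\<zero>, x) \<in> J}"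
      using split[of "fst p" "snd p"] join[of "fst p" "snd p"]
      by (simp only: mem_Times_iff mem_Collect_eq prod.collapse) blast
  qed
qed

end

theorem proposition3p6:
  fixes A :: "('a, 'm) ring_scheme" and E :: "('a, 'b, 'n) module_scheme"
  assumes "von_neumann_regular_ring A"
    and "multiplication_module A E"
  shows "SSP_ring (idealization A E)"
proof -
  interpret A: von_neumann_regular_ring A by fact
  interpret E: multiplication_module A E by fact
  interpret AE: module_over_von_neumann_regular_ring A E by unfold_locales
  interpret S: cring "idealization A E" by (rule E.cring_idealization)
  show ?thesis
  proof unfold_locales
    fix J assume J: "ideal J (idealization A E)"
    interpret J: ideal J "idealization A E" by fact
    define I where "I = {a. (a, \<zero>\<^bsub>E\<^esub>) \<in> J}"
    define N where "N = {x. (\<zero>\<^bsub>A\<^esub>, x) \<in> J}"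
    have J_eq: "J = I \<times> N"
      unfolding I_def N_def by (rule AE.ideal_idealization_homogeneous[OF J])
    have I: "ideal I A"
      unfolding I_def by (rule E.ideal_zero_section[OF J])
    obtain K where K: "ideal K A" and N: "N = ideal_smult K E"
      using E.multiplication E.submodule_zero_section[OF J] unfolding N_def by blast
    define L where "L = I <+>\<^bsub>A\<^esub> K"
    have L: "ideal L A"
      unfolding L_def by (rule A.add_ideals[OF I K])
    have "I \<subseteq> L"
    proof
      fix i assume i: "i \<in> I"
      have "i \<oplus>\<^bsub>A\<^esub> \<zero>\<^bsub>A\<^esub> \<in> L"
        unfolding L_def using i additive_subgroup.zero_closed[OF ideal.axioms(1)[OF K]]
        by (auto simp: set_add_def')
      then show "i \<in> L" using ideal.Icarr[OF I i] by simp
    qed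
    have "a \<odot>\<^bsub>E\<^esub> x \<in> N" if "a \<in> I" "x \<in> carrier E" for a x
      using J.I_r_closed[of "(a, \<zero>\<^bsub>E\<^esub>)" "(\<zero>\<^bsub>A\<^esub>, x)"] that ideal.Icarr[OF I that(1)]
      by (simp add: idealization_simps I_def N_def)
    then have "ideal_smult L E = N"
      unfolding L_def N by (rule E.ideal_smult_add_absorb[OF I K])
    then have "J = ideal_prod (idealization A E) (I \<times> carrier E) (L \<times> carrier E)"
      using AE.ideal_prod_idealization[OF I L \<open>I \<subseteq> L\<close>] J_eq by simp
    moreover have rad: "radical_ideal (I \<times> carrier E) (idealization A E)"
      "radical_ideal (L \<times> carrier E) (idealization A E)"
      using AE.radical_ideal_times_carrier I L by blast+
    moreover have "ideal_prod (idealization A E) (L \<times> carrier E) (carrier (idealization A E))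
        = L \<times> carrier E"
      by (rule S.ideal_prod_one) (rule E.ideal_times_carrier[OF L])
    ultimately show "\<exists>Js. (\<forall>J \<in> set Js. radical_ideal J (idealization A E)) \<and>
        J = foldr (ideal_prod (idealization A E)) Js (carrier (idealization A E))"
      by (intro exI[of _ "[I \<times> carrier E, L \<times> carrier E]"]) simp
  qed
qed

end
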